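(* For all integers $n\ge 0$ and all real $q\in(0,1]$, $$\mathcal{A}\bigl((t+q)^n\bigr)\prec\mathcal{A}\bigl((t+q)^{n+1}\bigr).$$ In particular, $\mathcal{A}\bigl((t+q)^n\bigr)$ has only real and distinct zeros.
   Context: For $n\ge 0$, the $n$-th Eulerian polynomial is $A_n(t)=\sum_{k=0}^n A_{nk}t^k$, where $A_{nk}$ is the number of permutations $\sigma$ of $\{1,\dots,n\}$ such that $\sigma(i)\ge i$ for exactly $k$ indices $i$ (so $A_0(t)=1$). The map $\mathcal{A}:\mathbb{R}[t]\to\mathbb{R}[t]$ is the $\mathbb{R}$-linear operator determined by $\mathcal{A}(t^n)=A_n(t)$ for all $n\ge 0$. Let $f,g\in\mathbb{R}[t]$ be polynomials with positive leading coefficients and only real zeros. Let $\alpha_1\ge\alpha_2\ge\cdots\ge\alpha_n$ be the zeros of $f$ and $\beta_1\ge\beta_2\ge\cdots\ge\beta_m$ the zeros of $g$ (with multiplicity). One says $g$ interlaces $f$, written $g\preceq f$, if $\cdots\le\beta_2\le\alpha_2\le\beta_1\le\alpha_1$ (so in particular $\deg g\le\deg f\le\deg g+1$). One says $g$ strictly interlaces $f$, written $g\prec f$, if moreover all these inequalities are strict: $\cdots<\beta_2<\alpha_2<\beta_1<\alpha_1$. In particular, the assertion $g\prec f$ includes that $f$ and $g$ have only real zeros. *)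

theory Defs
  imports
    Complex_Main
    "HOL-Computational_Algebra.Polynomial"
    "HOL-Combinatorics.Permutations"
begin

definition eulerian_number :: "nat \<Rightarrow> nat \<Rightarrow> nat" where
  "eulerian_number n k =
     card {\<sigma>. \<sigma> permutes {1..n} \<and> card {i \<in> {1..n}. \<sigma> i \<ge> i} = k}"

definition eulerian_poly :: "nat \<Rightarrow> real poly" where
  "eulerian_poly n = (\<Sum>k\<le>n. monom (real (eulerian_number n k)) k)"

(* eulerian_op_add, eulerian_op_smult, eulerian_op_monom and eulerian_op_unique show that
   this is the unique R-linear map sending t^n to eulerian_poly n. *)
definition eulerian_op :: "real poly \<Rightarrow> real poly" where
  "eulerian_op p = (\<Sum>n\<le>degree p. smult (coeff p n) (eulerian_poly n))"

lemma eulerian_op_altdef: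
  assumes "degree p \<le> N"
  shows "eulerian_op p = (\<Sum>n\<le>N. smult (coeff p n) (eulerian_poly n))"
  unfolding eulerian_op_def
  by (rule sum.mono_neutral_left) (use assms in \<open>auto simp: coeff_eq_0\<close>)

lemma eulerian_op_add: "eulerian_op (p + r) = eulerian_op p + eulerian_op r"
proof -
  let ?N = "max (degree p) (degree r)"
  have "degree (p + r) \<le> ?N" "degree p \<le> ?N" "degree r \<le> ?N"
    by (simp_all add: degree_add_le)
  then show ?thesis
    by (simp add: eulerian_op_altdef[where N = ?N] smult_add_left sum.distrib)
qed

lemma eulerian_op_smult: "eulerian_op (smult c p) = smult c (eulerian_op p)"
proof -
  have smult_sum: "smult c (sum h A) = (\<Sum>i\<in>A. smult c (h i))" for h :: "nat \<Rightarrow> real poly" and A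
    by (induction A rule: infinite_finite_induct) (simp_all add: smult_add_right)
  show ?thesis
    by (simp add: eulerian_op_altdef[where N = "degree p"] smult_sum)
qed

lemma eulerian_op_monom: "eulerian_op (monom 1 n) = eulerian_poly n"
proof -
  have "eulerian_op (monom 1 n) = (\<Sum>k\<le>n. if n = k then eulerian_poly k else 0)"
    unfolding eulerian_op_def by (intro sum.cong) (auto simp: degree_monom_eq)
  then show ?thesis by simp
qed

lemma eulerian_op_unique:
  fixes L :: "real poly \<Rightarrow> real poly"
  assumes add: "\<And>p r. L (p + r) = L p + L r"
    and smult: "\<And>c p. L (smult c p) = smult c (L p)"
    and monom: "\<And>n. L (monom 1 n) = eulerian_poly n"
  shows "L = eulerian_op"
proof
  fix p
  have zero: "L 0 = 0" using smult[of 0 0] by simp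
  have L_sum: "L (sum h A) = (\<Sum>i\<in>A. L (h i))" if "finite A" for h and A :: "nat set"
    using that by (induction A rule: finite_induct) (simp_all add: zero add)
  have L_monom: "L (monom c n) = smult c (eulerian_poly n)" for c n
    using smult[of c "monom 1 n"] by (simp add: monom smult_monom)
  have "L p = L (\<Sum>n\<le>degree p. monom (coeff p n) n)"
    by (simp add: poly_as_sum_of_monoms)
  also have "\<dots> = eulerian_op p"
    by (simp add: L_sum L_monom eulerian_op_def)
  finally show "L p = eulerian_op p" .
qed

definition only_real_zeros :: "real poly \<Rightarrow> bool" where
  "only_real_zeros p \<longleftrightarrow> (\<forall>z::complex. poly (map_poly of_real p) z = 0 \<longrightarrow> z \<in> \<real>)"

(* Real zeros with multiplicity, in weakly decreasing order. *)
definition zeros_desc :: "real poly \<Rightarrow> real list" where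
  "zeros_desc p = rev (sorted_list_of_multiset (proots p))"

(* Argument order: strictly_interlaces g f stands for "g strictly interlaces f".
   List indices start at 0, so the zero of f at i + 1 is compared with that of g at i.
   The length conditions express that the chain starts with the largest zero of f and
   alternates until both lists are exhausted. *)
definition strictly_interlaces :: "real poly \<Rightarrow> real poly \<Rightarrow> bool"  (infix "\<prec>\<^sub>s" 50) where
  "g \<prec>\<^sub>s f \<longleftrightarrow>
     lead_coeff g > 0 \<and> lead_coeff f > 0 \<and> only_real_zeros g \<and> only_real_zeros f \<and>
     (let \<alpha> = zeros_desc f; \<beta> = zeros_desc g in
        length \<beta> \<le> length \<alpha> \<and> length \<alpha> \<le> length \<beta> + 1 \<and>
        (\<forall>i < length \<beta>. \<beta> ! i < \<alpha> ! i) \<and>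
        (\<forall>i. i + 1 < length \<alpha> \<longrightarrow> \<alpha> ! (i + 1) < \<beta> ! i))"

end

theory Submission
  imports Defs
begin

text \<open>
  Let \<open>P n\<close> be the image of \<open>(t + q)^n\<close>, that is, the sum of \<open>(n choose k) q^(n-k) A\<^sub>k\<close> over \<open>k\<close>.
  The classical proof that the zeros of the Eulerian polynomials are real uses the recurrence
  \<open>A\<^sub>n\<^sub>+\<^sub>1 = (n + 1) t A\<^sub>n + t (1 - t) A\<^sub>n'\<close>: at a zero \<open>x < 0\<close> of \<open>A\<^sub>n\<close> the sign of \<open>A\<^sub>n\<^sub>+\<^sub>1\<close> is
  opposite to that of \<open>A\<^sub>n'\<close>, and the intermediate value theorem gives interlacing zeros
  (\<open>interlacing_step\<close>). For \<open>P n\<close> the recurrence has the extra term \<open>- n q t P (n-1)\<close>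
  (\<open>euler_appell_Suc\<close>), whose sign is unfavourable.

  The way out is to replace the constant \<open>q\<close> by the polynomial \<open>v (1 - t)\<close> with \<open>0 < v < 1\<close>. The
  resulting polynomials \<open>B n\<close> are the numerators of the series \<open>\<Sum>m. (m + v)^n t^m\<close> with
  denominator \<open>(1 - t)^(n+1)\<close>. For them the extra term cancels, so the classical argument
  shows that the zeros of \<open>B n\<close> are simple and negative and that \<open>B n\<close> strictly
  interlaces \<open>B (n+1)\<close> (\<open>shifted_interlacing_step\<close>).

  The two families meet at a point: for \<open>x < 0\<close> and \<open>v = q / (1 - x)\<close>, which lies strictly between
  \<open>0\<close> and \<open>1\<close> because \<open>0 < q \<le> 1\<close>, all values \<open>P k x\<close> and \<open>B k x\<close> coincide. If \<open>x\<close> is a zero of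
  \<open>P n\<close>, it is a zero of this particular \<open>B n\<close>, and the interlacing of the \<open>B k\<close> determines the
  relative signs of \<open>P (n+1)\<close> and \<open>(P n)'\<close> at \<open>x\<close>: they are opposite
  (\<open>eulerian_transform_opposite_sign\<close>). A different \<open>v\<close> is used at each zero, but the sign
  condition is all that the intermediate value argument needs, so it applies to the \<open>P n\<close> as well.
\<close>

section \<open>The recurrence of the Eulerian polynomials\<close>

definition weak_exc :: "nat \<Rightarrow> (nat \<Rightarrow> nat) \<Rightarrow> nat" where
  "weak_exc n \<sigma> = card {i \<in> {1..n}. i \<le> \<sigma> i}"

lemma weak_exc_le: "weak_exc n \<sigma> \<le> n"
proof -
  have "weak_exc n \<sigma> \<le> card {1..n}"
    unfolding weak_exc_def by (rule card_mono) auto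
  then show ?thesis by simp
qed

lemma eulerian_poly_conv_weak_exc:
  "eulerian_poly n = (\<Sum>\<sigma> | \<sigma> permutes {1..n}. monom 1 (weak_exc n \<sigma>))"
proof -
  have "(\<Sum>\<sigma> | \<sigma> permutes {1..n}. monom 1 (weak_exc n \<sigma>)) =
        (\<Sum>k\<le>n. \<Sum>\<sigma> \<in> {\<sigma> \<in> {\<sigma>. \<sigma> permutes {1..n}}. weak_exc n \<sigma> = k}.
           monom (1::real) (weak_exc n \<sigma>))"
    by (rule sum.group [symmetric]) (auto simp: finite_permutations weak_exc_le)
  also have "\<dots> = (\<Sum>k\<le>n. monom (real (eulerian_number n k)) k)"
    by (intro sum.cong) (simp_all add: eulerian_number_def weak_exc_def of_nat_poly smult_monom)
  finally show ?thesis by (simp add: eulerian_poly_def)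
qed

lemma weak_exc_extend_fixed:
  assumes "\<sigma> permutes {1..n}"
  shows "weak_exc (Suc n) \<sigma> = Suc (weak_exc n \<sigma>)"
proof -
  have "\<sigma> (Suc n) = Suc n"
    using assms by (simp add: permutes_def)
  then have "{i \<in> {1..Suc n}. i \<le> \<sigma> i} = insert (Suc n) {i \<in> {1..n}. i \<le> \<sigma> i}"
    by (auto simp: le_Suc_eq)
  then show ?thesis
    by (simp add: weak_exc_def)
qed

text \<open>
  The permutations of \<open>{1..n+1}\<close> that move \<open>n+1\<close> arise from those of \<open>{1..n}\<close> by inserting
  \<open>n+1\<close> into a cycle between some \<open>i\<close> and \<open>\<sigma> i\<close>. After the insertion \<open>i\<close> is a weak excedance and
  \<open>n+1\<close> is not, so the number of weak excedances grows exactly if \<open>i\<close> was not one before.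
\<close>

lemma weak_exc_insert_in_cycle:
  assumes \<sigma>: "\<sigma> permutes {1..n}" and i: "i \<in> {1..n}"
  shows "weak_exc (Suc n) (transpose (Suc n) (\<sigma> i) \<circ> \<sigma>) = weak_exc n \<sigma> + (if \<sigma> i < i then 1 else 0)"
proof -
  let ?\<tau> = "transpose (Suc n) (\<sigma> i) \<circ> \<sigma>"
  have fix_Suc: "\<sigma> (Suc n) = Suc n"
    using \<sigma> by (simp add: permutes_def)
  have range: "\<sigma> j \<in> {1..n}" if "j \<in> {1..n}" for j
    using permutes_in_image[OF \<sigma>] that by blast
  have at_i: "?\<tau> i = Suc n" and at_Suc: "?\<tau> (Suc n) = \<sigma> i"
    by (simp_all add: fix_Suc)
  have elsewhere: "?\<tau> j = \<sigma> j" if "j \<in> {1..n}" "j \<noteq> i" for j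
  proof -
    have "\<sigma> j \<noteq> \<sigma> i"
      using that permutes_inj[OF \<sigma>] by (auto dest: injD)
    moreover have "\<sigma> j \<noteq> Suc n"
      using range[OF that(1)] by auto
    ultimately show ?thesis by simp
  qed
  have iff: "j \<in> {1..Suc n} \<and> j \<le> ?\<tau> j \<longleftrightarrow> j = i \<or> (j \<in> {1..n} \<and> j \<le> \<sigma> j)" for j
  proof (cases "j = i \<or> j = Suc n")
    case True
    then show ?thesis
      using at_i at_Suc i range[OF i] by (auto simp del: comp_apply)
  next
    case False
    then show ?thesis
      using elsewhere[of j] by (auto simp: le_Suc_eq simp del: comp_apply)
  qed
  then have "{j \<in> {1..Suc n}. j \<le> ?\<tau> j} = insert i {j \<in> {1..n}. j \<le> \<sigma> j}"
    by blast
  then show ?thesis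
    using i by (simp add: weak_exc_def card_insert_if del: comp_apply)
qed

text \<open>
  A permutation \<open>\<sigma>\<close> of \<open>{1..n}\<close> with \<open>e\<close> weak excedances has \<open>n + 1\<close> extensions to \<open>{1..n+1}\<close>:
  one fixes \<open>n+1\<close>, \<open>e\<close> insertions keep the number of weak excedances and \<open>n - e\<close> raise it by one.
  Together they contribute
  \<open>t^(e+1) + e t^e + (n - e) t^(e+1) = (n+1) t t^e + t (1 - t) (t^e)'\<close>.
\<close>

lemma eulerian_poly_Suc:
  "eulerian_poly (Suc n) =
     [:0, real (Suc n):] * eulerian_poly n + [:0, 1, -1:] * pderiv (eulerian_poly n)"
proof -
  let ?S = "{\<sigma>. \<sigma> permutes {1..n}}"
  let ?m = "monom (1::real)"
  have step: "(\<Sum>b\<in>insert (Suc n) {1..n}. ?m (weak_exc (Suc n) (transpose (Suc n) b \<circ> \<sigma>))) =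
      [:0, real (Suc n):] * ?m (weak_exc n \<sigma>) + [:0, 1, -1:] * pderiv (?m (weak_exc n \<sigma>))"
    if \<sigma>: "\<sigma> permutes {1..n}" for \<sigma>
  proof -
    let ?e = "weak_exc n \<sigma>"
    let ?X = "{i \<in> {1..n}. i \<le> \<sigma> i}" and ?Y = "{i \<in> {1..n}. \<sigma> i < i}"
    have X: "card ?X = ?e" by (simp add: weak_exc_def)
    have Y: "card ?Y = n - ?e"
    proof -
      have "?Y = {1..n} - ?X" by auto
      moreover have "card ({1..n} - ?X) = card {1..n} - card ?X"
        by (rule card_Diff_subset) auto
      ultimately have "card ?Y = card {1..n} - card ?X"
        by (simp only:)
      then show ?thesis by (simp only: X) simp
    qed
    have split: "{1..n} = ?X \<union> ?Y" "?X \<inter> ?Y = {}" by auto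
    have "(\<Sum>b\<in>{1..n}. ?m (weak_exc (Suc n) (transpose (Suc n) b \<circ> \<sigma>))) =
          (\<Sum>i\<in>{1..n}. ?m (weak_exc (Suc n) (transpose (Suc n) (\<sigma> i) \<circ> \<sigma>)))"
      by (subst sum.permute[OF \<sigma>]) (simp add: o_def)
    also have "\<dots> = (\<Sum>i\<in>{1..n}. ?m (?e + (if \<sigma> i < i then 1 else 0)))"
      by (intro sum.cong refl) (simp only: weak_exc_insert_in_cycle[OF \<sigma>])
    also have "\<dots> = (\<Sum>i\<in>?X. ?m (?e + (if \<sigma> i < i then 1 else 0))) +
                    (\<Sum>i\<in>?Y. ?m (?e + (if \<sigma> i < i then 1 else 0)))"
      by (subst split(1), rule sum.union_disjoint) auto
    also have "(\<Sum>i\<in>?X. ?m (?e + (if \<sigma> i < i then 1 else 0))) = (\<Sum>i\<in>?X. ?m ?e)"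
      by (rule sum.cong) auto
    also have "(\<Sum>i\<in>?Y. ?m (?e + (if \<sigma> i < i then 1 else 0))) = (\<Sum>i\<in>?Y. ?m (Suc ?e))"
      by (rule sum.cong) auto
    finally have sum_b: "(\<Sum>b\<in>{1..n}. ?m (weak_exc (Suc n) (transpose (Suc n) b \<circ> \<sigma>))) =
        of_nat ?e * ?m ?e + of_nat (n - ?e) * ?m (Suc ?e)"
      by (simp only: sum_constant X Y)
    have "(\<Sum>b\<in>insert (Suc n) {1..n}. ?m (weak_exc (Suc n) (transpose (Suc n) b \<circ> \<sigma>))) =
        ?m (weak_exc (Suc n) (transpose (Suc n) (Suc n) \<circ> \<sigma>)) +
        (\<Sum>b\<in>{1..n}. ?m (weak_exc (Suc n) (transpose (Suc n) b \<circ> \<sigma>)))"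
      by (rule sum.insert) auto
    also have "\<dots> = ?m (Suc ?e) + (of_nat ?e * ?m ?e + of_nat (n - ?e) * ?m (Suc ?e))"
      unfolding sum_b by (simp add: weak_exc_extend_fixed[OF \<sigma>])
    also have "\<dots> = [:0, real (Suc n):] * ?m ?e + [:0, 1, -1:] * pderiv (?m ?e)"
      using weak_exc_le[of n \<sigma>]
      by (intro poly_eqI)
         (auto simp: pderiv_monom of_nat_poly coeff_pCons of_nat_diff smult_monom algebra_simps split: nat.splits)
    finally show ?thesis .
  qed
  have "eulerian_poly (Suc n) = (\<Sum>\<sigma> | \<sigma> permutes (insert (Suc n) {1..n}). ?m (weak_exc (Suc n) \<sigma>))"
    by (simp add: eulerian_poly_conv_weak_exc atLeastAtMostSuc_conv)
  also have "\<dots> = (\<Sum>b\<in>insert (Suc n) {1..n}. \<Sum>\<sigma>\<in>?S. ?m (weak_exc (Suc n) (transpose (Suc n) b \<circ> \<sigma>)))"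
    by (rule sum_over_permutations_insert) auto
  also have "\<dots> = (\<Sum>\<sigma>\<in>?S. \<Sum>b\<in>insert (Suc n) {1..n}. ?m (weak_exc (Suc n) (transpose (Suc n) b \<circ> \<sigma>)))"
    by (rule sum.swap)
  also have "\<dots> = (\<Sum>\<sigma>\<in>?S. [:0, real (Suc n):] * ?m (weak_exc n \<sigma>) +
                     [:0, 1, -1:] * pderiv (?m (weak_exc n \<sigma>)))"
    by (intro sum.cong refl) (rule step, simp)
  also have "\<dots> = [:0, real (Suc n):] * eulerian_poly n + [:0, 1, -1:] * pderiv (eulerian_poly n)"
    unfolding eulerian_poly_conv_weak_exc higher_pderiv_sum[of 1, simplified] sum_distrib_left sum.distrib ..
  finally show ?thesis .
qed

lemma eulerian_poly_0: "eulerian_poly 0 = 1"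
  by (simp add: eulerian_poly_conv_weak_exc weak_exc_def)

section \<open>Binomial transforms\<close>

text \<open>
  With \<open>F = eulerian_poly\<close> and a constant \<open>c = q\<close> this is the image of \<open>(t + q)^n\<close> under the Eulerian
  operator. The parameter \<open>c\<close> is an arbitrary ring element because the proof also needs the
  polynomial \<open>c = v (1 - t)\<close>.
\<close>

definition binomial_transform :: "'a::comm_ring_1 \<Rightarrow> (nat \<Rightarrow> 'a) \<Rightarrow> nat \<Rightarrow> 'a" where
  "binomial_transform c F n = (\<Sum>k\<le>n. of_nat (n choose k) * c ^ (n - k) * F k)"

text \<open>
  Pascal's rule.
\<close>

lemma binomial_transform_Suc:
  "binomial_transform c F (Suc n) =
     c * binomial_transform c F n + binomial_transform c (\<lambda>k. F (Suc k)) n"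
proof -
  have "c * binomial_transform c F n = (\<Sum>k\<le>n. of_nat (n choose k) * c ^ (Suc n - k) * F k)"
    unfolding binomial_transform_def sum_distrib_left
    by (intro sum.cong) (auto simp: Suc_diff_le algebra_simps)
  also have "\<dots> = (\<Sum>k\<le>Suc n. of_nat (n choose k) * c ^ (Suc n - k) * F k)"
    by (simp add: binomial_eq_0)
  also have "\<dots> = c ^ Suc n * F 0 + (\<Sum>k\<le>n. of_nat (n choose Suc k) * c ^ (n - k) * F (Suc k))"
    by (subst sum.atMost_Suc_shift) simp
  finally show ?thesis
    unfolding binomial_transform_def
    by (subst sum.atMost_Suc_shift) (simp add: sum.distrib algebra_simps)
qed

lemma binomial_transform_absorb:
  "(\<Sum>k\<le>n. of_nat (n choose k) * of_nat (n - k) * c ^ (n - k - 1) * F k) =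
     of_nat n * binomial_transform c F (n - 1)"
proof (cases n)
  case (Suc m)
  have absorb: "of_nat (n choose k) * of_nat (n - k) = (of_nat n * of_nat (m choose k) :: 'a)" for k
    using binomial_absorb_comp[of n k] Suc
    by (simp add: mult.commute del: of_nat_Suc flip: of_nat_mult)
  have "(\<Sum>k\<le>n. of_nat (n choose k) * of_nat (n - k) * c ^ (n - k - 1) * F k) =
        (\<Sum>k\<le>Suc m. of_nat n * (of_nat (m choose k) * c ^ (m - k) * F k))"
    unfolding absorb using Suc by (intro sum.cong) (auto simp: mult.assoc)
  then show ?thesis
    by (simp add: Suc binomial_transform_def sum_distrib_left binomial_eq_0 del: of_nat_Suc)
qed simp

lemma binomial_transform_weighted:
  "binomial_transform c (\<lambda>k. of_nat k * F k) n =
     of_nat n * binomial_transform c F n - of_nat n * c * binomial_transform c F (n - 1)"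
proof -
  have "of_nat n * c * binomial_transform c F (n - 1) =
        c * (\<Sum>k\<le>n. of_nat (n choose k) * of_nat (n - k) * c ^ (n - k - 1) * F k)"
    by (simp only: binomial_transform_absorb) (simp only: mult_ac)
  also have "\<dots> = (\<Sum>k\<le>n. of_nat (n - k) * (of_nat (n choose k) * c ^ (n - k) * F k))"
    unfolding sum_distrib_left
  proof (intro sum.cong refl)
    fix k
    show "c * (of_nat (n choose k) * of_nat (n - k) * c ^ (n - k - 1) * F k) =
          of_nat (n - k) * (of_nat (n choose k) * c ^ (n - k) * F k)"
      by (cases "n - k") (simp_all add: mult_ac)
  qed
  also have "\<dots> = of_nat n * binomial_transform c F n - binomial_transform c (\<lambda>k. of_nat k * F k) n"
    unfolding binomial_transform_def sum_distrib_left sum_subtractf [symmetric]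
    by (intro sum.cong) (auto simp: of_nat_diff algebra_simps)
  finally show ?thesis by (simp add: algebra_simps)
qed

text \<open>
  The last summand is the chain rule for the Appell property: the derivative of the
  transform with respect to the parameter \<open>c\<close> is \<open>n\<close> times its predecessor.
\<close>

lemma pderiv_binomial_transform:
  fixes c :: "'a::{idom,semiring_char_0} poly"
  shows "pderiv (binomial_transform c F n) = binomial_transform c (\<lambda>k. pderiv (F k)) n
     + of_nat n * pderiv c * binomial_transform c F (n - 1)"
proof -
  have of_nat_pderiv: "pderiv (of_nat m :: 'a poly) = 0" for m
    by (simp add: of_nat_poly)
  have power: "pderiv (c ^ m) = of_nat m * c ^ (m - 1) * pderiv c" for m
    by (simp add: pderiv_power of_nat_poly)
  have "pderiv (binomial_transform c F n) = (\<Sum>k\<le>n. of_nat (n choose k) * c ^ (n - k) * pderiv (F k)) +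
          pderiv c * (\<Sum>k\<le>n. of_nat (n choose k) * of_nat (n - k) * c ^ (n - k - 1) * F k)"
    unfolding binomial_transform_def higher_pderiv_sum[of 1, simplified] sum_distrib_left sum.distrib [symmetric]
    by (intro sum.cong refl) (simp only: pderiv_mult power of_nat_pderiv, simp only: algebra_simps mult_zero_left add_0_left)
  then show ?thesis
    by (simp only: binomial_transform_absorb binomial_transform_def [symmetric]) (simp only: mult_ac)
qed

section \<open>Simple negative zeros and interlacing\<close>

text \<open>
  Since \<open>n\<close> is the degree, the \<open>n\<close> listed zeros are all complex zeros of \<open>p\<close> and they are simple.
  The decreasing order makes the sign of \<open>p'\<close> at \<open>r i\<close> equal to \<open>(-1)^i\<close>.
\<close>

definition neg_zeros :: "real poly \<Rightarrow> nat \<Rightarrow> (nat \<Rightarrow> real) \<Rightarrow> bool" where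
  "neg_zeros p n r \<longleftrightarrow> degree p = n \<and> 0 < lead_coeff p \<and>
     (\<forall>i<n. r i < 0 \<and> poly p (r i) = 0) \<and> (\<forall>i j. i < j \<longrightarrow> j < n \<longrightarrow> r j < r i)"

lemma neg_zeros_inj: "neg_zeros p n r \<Longrightarrow> inj_on r {..<n}"
  unfolding neg_zeros_def inj_on_def by (metis lessThan_iff less_irrefl nat_neq_iff)

lemma neg_zeros_factorization:
  assumes "neg_zeros p n r"
  shows "p = smult (lead_coeff p) (\<Prod>i<n. [:- r i, 1:])"
proof -
  let ?f = "\<Prod>i<n. [:- r i, 1:]"
  have n: "degree p = n" and c: "lead_coeff p \<noteq> 0"
    using assms by (auto simp: neg_zeros_def)
  have deg: "degree ?f = n"
    by (subst degree_prod_eq_sum_degree) auto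
  have lc: "lead_coeff ?f = 1"
    by (simp add: lead_coeff_prod)
  show ?thesis
  proof (rule poly_eqI_degree_lead_coeff[where n = n and A = "r ` {..<n}"])
    show "coeff p n = coeff (smult (lead_coeff p) ?f) n"
      using n deg lc by simp
    show "n \<le> card (r ` {..<n})"
      using card_image[OF neg_zeros_inj[OF assms]] by simp
    show "poly p z = poly (smult (lead_coeff p) ?f) z" if "z \<in> r ` {..<n}" for z
      using that assms by (auto simp: neg_zeros_def poly_prod)
  qed (use n deg c in auto)
qed

lemma neg_zeros_poly:
  assumes "neg_zeros p n r"
  shows "poly p x = lead_coeff p * (\<Prod>i<n. x - r i)"
  by (subst neg_zeros_factorization[OF assms]) (simp add: poly_prod)

lemma neg_zeros_zeroE:
  assumes "neg_zeros p n r" "poly p x = 0"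
  obtains i where "i < n" "x = r i"
proof -
  have "lead_coeff p \<noteq> 0"
    using assms(1) by (auto simp: neg_zeros_def)
  then show ?thesis
    using that assms(2) neg_zeros_poly[OF assms(1), of x] by auto
qed

lemma sign_prod_diff:
  fixes x :: real
  assumes "finite K" "\<And>j. j \<in> K \<Longrightarrow> i \<le> j" "\<And>j. j < i \<Longrightarrow> x < r j" "\<And>j. j \<in> K \<Longrightarrow> r j < x"
  shows "0 < (- 1) ^ i * (\<Prod>j\<in>{..<i} \<union> K. x - r j)"
proof -
  have "(\<Prod>j\<in>{..<i} \<union> K. x - r j) = (\<Prod>j<i. x - r j) * (\<Prod>j\<in>K. x - r j)"
    by (rule prod.union_disjoint) (use assms(1,2) in \<open>auto simp: not_less [symmetric]\<close>)
  moreover have "(- 1) ^ i * (\<Prod>j<i. x - r j) = (\<Prod>j<i. r j - x)"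
    by (induction i) (simp_all add: algebra_simps)
  moreover have "0 < (\<Prod>j<i. r j - x)" "0 < (\<Prod>j\<in>K. x - r j)"
    using assms(3,4) by (auto intro!: prod_pos)
  ultimately show ?thesis
    by (simp add: mult.assoc [symmetric])
qed

text \<open>
  Exactly \<open>i\<close> zeros lie to the right of \<open>x\<close>, so exactly \<open>i\<close> linear factors are negative.
\<close>

lemma sign_between_zeros:
  assumes p: "neg_zeros p n r" and "i \<le> n" "\<And>j. j < i \<Longrightarrow> x < r j" "\<And>j. i \<le> j \<Longrightarrow> j < n \<Longrightarrow> r j < x"
  shows "0 < (- 1) ^ i * poly p x"
proof -
  have "{..<n} = {..<i} \<union> {i..<n}" using assms(2) by auto
  moreover have "0 < (- 1) ^ i * (\<Prod>j\<in>{..<i} \<union> {i..<n}. x - r j)"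
    by (rule sign_prod_diff) (use assms in auto)
  moreover have "0 < lead_coeff p" using p unfolding neg_zeros_def by blast
  ultimately show ?thesis
    unfolding neg_zeros_poly[OF p] by (simp add: mult.left_commute)
qed

lemma sign_pderiv_at_zero:
  assumes p: "neg_zeros p n r" and i: "i < n"
  shows "0 < (- 1) ^ i * poly (pderiv p) (r i)"
proof -
  let ?x = "r i"
  have "p = smult (lead_coeff p) ([:- ?x, 1:] * (\<Prod>j\<in>{..<n} - {i}. [:- r j, 1:]))"
    using neg_zeros_factorization[OF p] i by (simp add: prod.remove[of "{..<n}" i])
  then have "pderiv p = pderiv (smult (lead_coeff p) ([:- ?x, 1:] * (\<Prod>j\<in>{..<n} - {i}. [:- r j, 1:])))"
    by (rule arg_cong)
  then have "poly (pderiv p) ?x = lead_coeff p * (\<Prod>j\<in>{..<n} - {i}. ?x - r j)"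
    by (simp only: pderiv_smult pderiv_mult) (simp add: poly_prod pderiv_pCons)
  moreover have "{..<n} - {i} = {..<i} \<union> {i<..<n}" using i by auto
  moreover have "0 < (- 1) ^ i * (\<Prod>j\<in>{..<i} \<union> {i<..<n}. ?x - r j)"
    by (rule sign_prod_diff) (use p i in \<open>auto simp: neg_zeros_def\<close>)
  moreover have "0 < lead_coeff p" using p unfolding neg_zeros_def by blast
  ultimately show ?thesis by (simp add: mult.left_commute)
qed

lemma poly_sign_at_bot:
  assumes "0 < lead_coeff (p :: real poly)"
  shows "\<exists>M<b. 0 < (- 1) ^ degree p * poly p M"
proof -
  let ?q = "smult ((- 1) ^ degree p) (p \<circ>\<^sub>p [:0, -1:])"
  have "degree (p \<circ>\<^sub>p [:0, -1:]) = degree p"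
    by (simp add: degree_pcompose)
  moreover have "lead_coeff (p \<circ>\<^sub>p [:0, -1:]) = lead_coeff p * (- 1) ^ degree p"
    by (subst lead_coeff_comp) simp_all
  ultimately have "lead_coeff ?q = lead_coeff p"
    by (cases "even (degree p)") simp_all
  then obtain N where N: "\<And>x. N \<le> x \<Longrightarrow> lead_coeff p \<le> poly ?q x"
    using poly_pinfty_gt_lc[of ?q] assms by auto
  define x where "x = max N (1 - b)"
  have "0 < poly ?q x"
    using N[of x] assms by (auto simp: x_def)
  then show ?thesis
    by (intro exI[of _ "- x"]) (auto simp: poly_pcompose x_def)
qed

definition zeros_alternate :: "nat \<Rightarrow> (nat \<Rightarrow> real) \<Rightarrow> (nat \<Rightarrow> real) \<Rightarrow> bool" where
  "zeros_alternate n r s \<longleftrightarrow> (\<forall>i<n. s (Suc i) < r i \<and> r i < s i)"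

text \<open>
  At the zeros of \<open>f\<close>, where the signs of \<open>f'\<close> alternate, \<open>g\<close> has the sign opposite to \<open>f'\<close>.
  Adding the point \<open>0\<close> on the right and a point \<open>M\<close> far on the left gives \<open>n + 2\<close> points with
  alternating signs of \<open>g\<close>, hence \<open>n + 1\<close> zeros of \<open>g\<close> that are separated by the zeros of \<open>f\<close>.
  This is the only source of real zeros in the whole argument.
\<close>

lemma interlacing_step:
  assumes f: "neg_zeros f n r"
    and g: "degree g = Suc n" "0 < lead_coeff g" "0 < poly g 0"
    and opposite: "\<And>i. i < n \<Longrightarrow> poly g (r i) * poly (pderiv f) (r i) < 0"
  shows "\<exists>s. neg_zeros g (Suc n) s \<and> zeros_alternate n r s"
proof -
  have r_neg: "r i < 0" if "i < n" for i
    using f that by (simp add: neg_zeros_def)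
  have r_less: "r j < r i" if "i < j" "j < n" for i j
    using f that by (simp add: neg_zeros_def)
  obtain M where M: "M < (if n = 0 then 0 else r (n - 1))" "0 < (- 1) ^ Suc n * poly g M"
    using poly_sign_at_bot[OF g(2)] unfolding g(1) by blast
  define x where "x i = (if i = 0 then 0 else if i \<le> n then r (i - 1) else M)" for i
  have sign: "0 < (- 1) ^ i * poly g (x i)" if "i \<le> Suc n" for i
  proof -
    have "i = 0 \<or> (\<exists>j<n. i = Suc j) \<or> i = Suc n"
      using that by (cases i) auto
    then consider "i = 0" | j where "i = Suc j" "j < n" | "i = Suc n"
      by blast
    then show ?thesis
    proof cases
      case 2
      have "0 < (- 1) ^ Suc j * poly g (r j)"
        using opposite[OF 2(2)] sign_pderiv_at_zero[OF f 2(2)]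
        by (cases "even j") (auto simp: mult_less_0_iff)
      then show ?thesis
        using 2 by (simp add: x_def)
    qed (use g M in \<open>auto simp: x_def\<close>)
  qed
  have x_less: "x (Suc i) < x i" if "i \<le> n" for i
    using that M(1) r_neg r_less by (cases "i = n") (auto simp: x_def split: if_splits)
  have "\<exists>y. x (Suc i) < y \<and> y < x i \<and> poly g y = 0" if "i \<le> n" for i
  proof -
    have "poly g (x (Suc i)) * poly g (x i) < 0"
      using sign[of i] sign[of "Suc i"] that
      by (cases "even i") (auto simp: mult_less_0_iff)
    then show ?thesis
      using poly_IVT[OF x_less[OF that]] by auto
  qed
  then obtain s where s: "\<And>i. i \<le> n \<Longrightarrow> x (Suc i) < s i \<and> s i < x i \<and> poly g (s i) = 0"
    by metis
  have x_anti: "x j \<le> x i" if "i \<le> j" "j \<le> Suc n" for i j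
    using that
  proof (induction j rule: dec_induct)
    case (step k)
    then show ?case using x_less[of k] by simp
  qed simp
  have "s j < s i" if "i < j" "j < Suc n" for i j
    using s[of i] s[of j] x_anti[of "Suc i" j] that by simp
  moreover have "s i < 0" if "i < Suc n" for i
    using s[of i] x_anti[of 0 i] that by (simp add: x_def)
  ultimately have "neg_zeros g (Suc n) s"
    using g s by (simp add: neg_zeros_def)
  moreover have "zeros_alternate n r s"
    unfolding zeros_alternate_def
  proof (intro allI impI)
    fix i assume "i < n"
    then show "s (Suc i) < r i \<and> r i < s i"
      using s[of i] s[of "Suc i"] by (simp add: x_def)
  qed
  ultimately show ?thesis by blast
qed

text \<open>
  If the zeros of \<open>f\<close> separate those of \<open>g\<close>, then as many zeros of \<open>f\<close> as of \<open>g\<close> lie to the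
  right of a given zero of \<open>g\<close>, which makes the signs of \<open>f\<close> and \<open>g'\<close> agree there.
\<close>

lemma zeros_alternate_sign:
  assumes f: "neg_zeros f n r" and g: "neg_zeros g (Suc n) s" and alt: "zeros_alternate n r s"
    and x: "poly g x = 0"
  shows "0 < poly f x * poly (pderiv g) x"
proof -
  obtain i where i: "i < Suc n" "x = s i"
    using neg_zeros_zeroE[OF g x] .
  have s: "s j \<le> s i" if "i \<le> j" "j < Suc n" for i j
    using g that by (cases "i = j") (auto simp: neg_zeros_def less_imp_le)
  have alt': "s (Suc j) < r j" "r j < s j" if "j < n" for j
    using alt that by (simp_all add: zeros_alternate_def)
  have "x < r j" if "j < i" for j
    using alt'(1)[of j] s[of "Suc j" i] i that by simp
  moreover have "r j < x" if "i \<le> j" "j < n" for j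
    using alt'(2)[of j] s[of i j] i that by simp
  ultimately have "0 < (- 1) ^ i * poly f x"
    using sign_between_zeros[OF f] i by simp
  moreover have "0 < (- 1) ^ i * poly (pderiv g) x"
    using sign_pderiv_at_zero[OF g i(1)] i(2) by simp
  ultimately show ?thesis
    by (cases "even i") (auto simp: zero_less_mult_iff)
qed

lemma only_real_zeros_if_neg_zeros:
  assumes "neg_zeros p n r"
  shows "only_real_zeros p"
  unfolding only_real_zeros_def
proof (intro allI impI)
  fix z :: complex
  assume z: "poly (map_poly of_real p) z = 0"
  let ?P = "map_poly complex_of_real p"
  have p0: "p \<noteq> 0"
    using assms by (auto simp: neg_zeros_def)
  have deg: "degree ?P = n"
    using assms by (simp add: neg_zeros_def degree_map_poly)
  have eval: "poly ?P (of_real x) = of_real (poly p x)" for x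
    by (induction p) (simp_all add: map_poly_pCons)
  have P0: "?P \<noteq> 0"
    using p0 by (simp add: map_poly_eq_0_iff)
  let ?Z = "complex_of_real ` r ` {..<n}"
  have "?Z \<subseteq> {z. poly ?P z = 0}"
    using assms by (auto simp: eval neg_zeros_def)
  moreover have "card ?Z = n"
    using neg_zeros_inj[OF assms] by (simp add: card_image inj_on_def)
  moreover have "card {z. poly ?P z = 0} \<le> n"
    using card_poly_roots_bound[OF P0] deg by simp
  ultimately have "{z. poly ?P z = 0} = ?Z"
    using poly_roots_finite[OF P0] by (metis card_seteq)
  then have "z \<in> ?Z"
    using z by blast
  then show "z \<in> \<real>"
    by auto
qed

lemma zeros_desc_if_neg_zeros:
  assumes "neg_zeros p n r"
  shows "zeros_desc p = map r [0..<n]"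
proof -
  have c: "lead_coeff p \<noteq> 0"
    using assms by (auto simp: neg_zeros_def)
  have "proots p = proots (\<Prod>i<n. [:- r i, 1:])"
    using neg_zeros_factorization[OF assms] c by (metis proots_smult)
  also have "\<dots> = (\<Sum>i<n. {#r i#})"
    by (subst proots_prod) auto
  also have "\<dots> = mset (rev (map r [0..<n]))"
    by (induction n) auto
  finally have "zeros_desc p = rev (sort (rev (map r [0..<n])))"
    by (simp only: zeros_desc_def sorted_list_of_multiset_mset)
  moreover have "sorted (rev (map r [0..<n]))"
    unfolding sorted_rev_iff_nth_mono
    using assms by (auto simp: neg_zeros_def le_less)
  ultimately show ?thesis
    by (simp add: sorted_sort_id)
qed

lemma strictly_interlaces_if_zeros_alternate:
  assumes "neg_zeros f n r" "neg_zeros g (Suc n) s" "zeros_alternate n r s"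
  shows "f \<prec>\<^sub>s g"
  using assms
  by (auto simp: strictly_interlaces_def zeros_desc_if_neg_zeros zeros_alternate_def
        only_real_zeros_if_neg_zeros Let_def neg_zeros_def[of f] neg_zeros_def[of g] simp del: upt_Suc)

section \<open>The Appell sequence of the Eulerian polynomials\<close>

abbreviation euler_appell :: "real poly \<Rightarrow> nat \<Rightarrow> real poly" where
  "euler_appell c \<equiv> binomial_transform c eulerian_poly"

lemma euler_appell_0: "euler_appell c 0 = 1"
  by (simp add: binomial_transform_def eulerian_poly_0)

text \<open>
  The last term vanishes for \<open>c = v (1 - t)\<close>, because then \<open>c + (1 - t) c' = 0\<close>, but not for
  a nonzero constant \<open>c\<close>. This is why the parameter \<open>v (1 - t)\<close> is easier to handle.
\<close>

lemma euler_appell_Suc: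
  "euler_appell c (Suc n) = (c + [:0, real (Suc n):]) * euler_appell c n
     + [:0, 1, -1:] * pderiv (euler_appell c n)
     - of_nat n * [:0, 1:] * (c + [:1, -1:] * pderiv c) * euler_appell c (n - 1)"
proof -
  let ?A = eulerian_poly
  have pt: "binomial_transform c (\<lambda>k. p * F k) n = p * binomial_transform c F n" for p F
    by (simp add: binomial_transform_def sum_distrib_left mult_ac)
  have add: "binomial_transform c (\<lambda>k. F k + G k) n = binomial_transform c F n + binomial_transform c G n" for F G
    by (simp add: binomial_transform_def sum.distrib algebra_simps)
  have "binomial_transform c (\<lambda>k. ?A (Suc k)) n =
        binomial_transform c (\<lambda>k. [:0, 1:] * (of_nat k * ?A k) + ([:0, 1:] * ?A k + [:0, 1, -1:] * pderiv (?A k))) n"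
    by (rule arg_cong[where f = "\<lambda>F. binomial_transform c F n"])
       (auto simp: fun_eq_iff eulerian_poly_Suc of_nat_poly smult_add_left algebra_simps)
  also have "\<dots> = [:0, 1:] * (of_nat n * euler_appell c n - of_nat n * c * euler_appell c (n - 1))
      + ([:0, 1:] * euler_appell c n + [:0, 1, -1:] * binomial_transform c (\<lambda>k. pderiv (?A k)) n)"
    by (simp only: add pt binomial_transform_weighted)
  also have "binomial_transform c (\<lambda>k. pderiv (?A k)) n =
      pderiv (euler_appell c n) - of_nat n * pderiv c * euler_appell c (n - 1)"
    by (simp add: pderiv_binomial_transform)
  finally have *: "binomial_transform c (\<lambda>k. ?A (Suc k)) n =
      [:0, 1:] * (of_nat n * euler_appell c n - of_nat n * c * euler_appell c (n - 1))
      + ([:0, 1:] * euler_appell c n + [:0, 1, -1:] *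
          (pderiv (euler_appell c n) - of_nat n * pderiv c * euler_appell c (n - 1)))" .
  have X: "[:0, 1, -1:] = [:0, 1:] * [:1, -1::real:]" "[:0, real (Suc n):] = [:0, 1:] * (1 + of_nat n)"
    by (simp_all add: of_nat_poly one_pCons)
  show ?thesis
    unfolding binomial_transform_Suc * X by (simp only: algebra_simps)
qed

text \<open>
  The parameter enters only through its value at the point of evaluation. This
  permits trading the constant \<open>q\<close> for \<open>v (1 - t)\<close> at a single point.
\<close>

lemma poly_euler_appell_cong:
  assumes "poly c x = poly d x"
  shows "poly (euler_appell c n) x = poly (euler_appell d n) x"
  by (simp add: binomial_transform_def poly_sum assms)

text \<open>
  With \<open>c = a + b t\<close> the factor \<open>c + (1 - t) c'\<close> in the recurrence is the constant \<open>a + b\<close>, so its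
  last term has degree at most \<open>n\<close> and does not affect the coefficient of \<open>t^(n+1)\<close>. The other
  two terms multiply the top coefficient by \<open>b + (n + 1) - n = 1 + b\<close>.
\<close>

lemma degree_le_coeff_euler_appell:
  "degree (euler_appell [:a, b:] n) \<le> n \<and> coeff (euler_appell [:a, b:] n) n = (1 + b) ^ n"
proof (induction n rule: less_induct)
  case (less n)
  show ?case
  proof (cases n)
    case 0
    then show ?thesis by (simp add: euler_appell_0)
  next
    case (Suc m)
    let ?p = "euler_appell [:a, b:] m" and ?q = "euler_appell [:a, b:] (m - 1)"
    have p: "degree ?p \<le> m" "coeff ?p m = (1 + b) ^ m"
      using less[of m] Suc by auto
    have p0: "coeff ?p k = 0" if "m < k" for k
      using p(1) that by (simp add: coeff_eq_0)
    have q0: "m = 0 \<or> coeff ?q k = 0" if "m \<le> k" for k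
      using less[of "m - 1"] Suc that by (cases m) (auto intro!: coeff_eq_0)
    have rec: "coeff (euler_appell [:a, b:] n) (Suc k) = a * coeff ?p (Suc k) + (b + real (Suc m)) * coeff ?p k
       + (real (Suc k) * coeff ?p (Suc k) - real k * coeff ?p k) - (a + b) * (real m * coeff ?q k)" for k
    proof -
      have "[:a, b:] + [:1, -1:] * pderiv [:a, b:] = [:a + b:]"
        by (simp add: pderiv_pCons)
      then show ?thesis
        unfolding Suc euler_appell_Suc
        by (cases k) (simp_all add: coeff_pderiv of_nat_poly algebra_simps)
    qed
    have "coeff (euler_appell [:a, b:] n) k = 0" if "n < k" for k
      using that rec[of "k - 1"] q0[of "k - 1"] Suc by (cases k) (auto simp: p0 simp del: of_nat_Suc)
    moreover have "coeff (euler_appell [:a, b:] n) n = (1 + b) ^ n"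
      using rec[of m] q0[of m] by (auto simp: Suc p0 p(2) algebra_simps)
    ultimately show ?thesis
      by (auto intro: degree_le)
  qed
qed

lemma euler_appell_degree_lead_coeff:
  assumes "-1 < b"
  shows "degree (euler_appell [:a, b:] n) = n" "lead_coeff (euler_appell [:a, b:] n) = (1 + b) ^ n"
proof -
  have "coeff (euler_appell [:a, b:] n) n \<noteq> 0"
    using degree_le_coeff_euler_appell[of a b n] assms by simp
  then show "degree (euler_appell [:a, b:] n) = n"
    using degree_le_coeff_euler_appell[of a b n] by (simp add: le_degree le_antisym)
  then show "lead_coeff (euler_appell [:a, b:] n) = (1 + b) ^ n"
    using degree_le_coeff_euler_appell[of a b n] by simp
qed

lemma poly_euler_appell_at_0: "poly (euler_appell c n) 0 = poly c 0 ^ n"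
  by (induction n) (simp_all add: euler_appell_0 euler_appell_Suc)

lemma eulerian_op_linear_power: "eulerian_op ([:q, 1:] ^ n) = euler_appell [:q:] n"
  unfolding eulerian_op_def degree_linear_power binomial_transform_def
  by (intro sum.cong)
     (simp_all add: coeff_linear_poly_power poly_const_pow of_nat_poly mult.commute)

section \<open>Interlacing for the shift parameter \<open>v (1 - t)\<close>\<close>

lemma poly_shifted_Suc:
  assumes "c = [:v, - v:]"
  shows "poly (euler_appell c (Suc n)) x = (poly c x + real (Suc n) * x) * poly (euler_appell c n) x + x * (1 - x) * poly (pderiv (euler_appell c n)) x"
proof -
  have "c + [:1, -1:] * pderiv c = 0"
    by (simp add: assms pderiv_pCons)
  then show ?thesis
    unfolding euler_appell_Suc by (simp add: algebra_simps)
qed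

text \<open>
  At a zero \<open>x < 0\<close> of the \<open>n\<close>-th polynomial the two-term recurrence leaves only
  \<open>x (1 - x)\<close> times the derivative, which has the sign opposite to the derivative. The bound
  \<open>v < 1\<close> keeps the leading coefficient \<open>(1 - v)^n\<close> positive.
\<close>

lemma shifted_interlacing_step:
  assumes v: "0 < v" "v < 1" and r: "neg_zeros (euler_appell [:v, - v:] n) n r"
  shows "\<exists>s. neg_zeros (euler_appell [:v, - v:] (Suc n)) (Suc n) s \<and> zeros_alternate n r s"
proof (rule interlacing_step[OF r])
  fix i assume i: "i < n"
  let ?f = "euler_appell [:v, - v:] n"
  have neg: "r i < 0" and z: "poly ?f (r i) = 0"
    using r i by (auto simp: neg_zeros_def)
  have "poly (pderiv ?f) (r i) \<noteq> 0"
    using sign_pderiv_at_zero[OF r i] by auto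
  then have "r i * (1 - r i) * (poly (pderiv ?f) (r i))\<^sup>2 < 0"
    using neg by (intro mult_neg_pos) (auto intro: mult_neg_pos)
  then show "poly (euler_appell [:v, - v:] (Suc n)) (r i) * poly (pderiv ?f) (r i) < 0"
    by (subst poly_shifted_Suc[OF refl]) (simp add: z power2_eq_square mult_ac)
next
  have v': "-1 < - v" using v by simp
  show "degree (euler_appell [:v, - v:] (Suc n)) = Suc n"
    by (rule euler_appell_degree_lead_coeff(1)[OF v'])
  show "0 < lead_coeff (euler_appell [:v, - v:] (Suc n))"
    unfolding euler_appell_degree_lead_coeff(2)[OF v']
    by (rule zero_less_power) (use v in simp)
  show "0 < poly (euler_appell [:v, - v:] (Suc n)) 0"
    using v by (simp add: poly_euler_appell_at_0)
qed

lemma shifted_neg_zeros: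
  assumes "0 < v" "v < 1"
  shows "\<exists>r. neg_zeros (euler_appell [:v, - v:] n) n r"
proof (induction n)
  case 0
  then show ?case by (simp add: neg_zeros_def euler_appell_0)
next
  case (Suc n)
  then show ?case using shifted_interlacing_step[OF assms] by blast
qed

lemma shifted_sign:
  assumes v: "0 < v" "v < 1" and z: "poly (euler_appell [:v, - v:] (Suc n)) x = 0"
  shows "0 < poly (euler_appell [:v, - v:] n) x * poly (pderiv (euler_appell [:v, - v:] (Suc n))) x"
proof -
  obtain r where r: "neg_zeros (euler_appell [:v, - v:] n) n r"
    using shifted_neg_zeros[OF v] by blast
  then obtain s where "neg_zeros (euler_appell [:v, - v:] (Suc n)) (Suc n) s" "zeros_alternate n r s"
    using shifted_interlacing_step[OF v] by blast
  then show ?thesis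
    using zeros_alternate_sign[OF r _ _ z] by blast
qed

section \<open>Interlacing for a constant shift parameter\<close>

text \<open>
  Let \<open>P n\<close> and \<open>B n\<close> be the sequences with parameters \<open>q\<close> and \<open>v (1 - t)\<close>, where \<open>v = q / (1 - x)\<close> is
  chosen such that \<open>P k\<close> and \<open>B k\<close> agree at \<open>x\<close> for all \<open>k\<close>. As \<open>x\<close> is a zero of \<open>B n\<close>,
  the two-term recurrence gives \<open>P (n+1) x = B (n+1) x = x (1 - x) (B n)' x\<close>. The derivatives
  differ by a multiple of the predecessor,
  \<open>(1 - x) (P n)' x = (1 - x) (B n)' x + n q B (n-1) x\<close>, and both summands have the same sign since
  \<open>B (n-1)\<close> interlaces \<open>B n\<close>. The hypothesis \<open>q \<le> 1\<close> is what makes \<open>v < 1\<close> for every \<open>x < 0\<close>.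
\<close>

lemma eulerian_transform_opposite_sign:
  assumes q: "0 < q" "q \<le> 1" and x: "x < 0" and z: "poly (euler_appell [:q:] n) x = 0"
  shows "poly (euler_appell [:q:] (Suc n)) x * poly (pderiv (euler_appell [:q:] n)) x < 0"
proof (cases n)
  case 0
  then show ?thesis using z by (simp add: euler_appell_0)
next
  case (Suc m)
  define v where "v = q / (1 - x)"
  have v: "0 < v" "v < 1"
    using q x by (simp_all add: v_def divide_simps)
  let ?P = "\<lambda>k. euler_appell [:q:] k" and ?B = "\<lambda>k. euler_appell [:v, - v:] k"
  have q_eq: "q = v * (1 - x)"
    using x by (simp add: v_def)
  have PB: "poly (?P k) x = poly (?B k) x" for k
    by (intro poly_euler_appell_cong) (simp add: q_eq algebra_simps)
  have pos: "0 < poly (?B m) x * poly (pderiv (?B n)) x"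
    using shifted_sign[OF v, of m x] z PB[of n] Suc by simp
  define b d where "b = poly (?B m) x" and "d = poly (pderiv (?B n)) x"
  have next_P: "poly (?P (Suc n)) x = x * (1 - x) * d"
    using poly_shifted_Suc[OF refl, of v n x] PB[of n] PB[of "Suc n"] z by (simp add: d_def)
  have "poly (?P (Suc n)) x = x * (1 - x) * poly (pderiv (?P n)) x - real n * x * q * poly (?P m) x"
    unfolding euler_appell_Suc using z Suc by (simp add: pderiv_pCons algebra_simps)
  then have "x * ((1 - x) * poly (pderiv (?P n)) x) = x * ((1 - x) * d + real n * q * b)"
    unfolding next_P PB[of m] b_def by (simp add: algebra_simps)
  then have deriv: "(1 - x) * poly (pderiv (?P n)) x = (1 - x) * d + real n * q * b"
    using x by simp
  have "poly (?P (Suc n)) x * poly (pderiv (?P n)) x = x * d * ((1 - x) * poly (pderiv (?P n)) x)"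
    by (simp add: next_P)
  also have "\<dots> = x * ((1 - x) * d\<^sup>2 + real n * q * (b * d))"
    unfolding deriv by (simp add: algebra_simps power2_eq_square)
  also have "\<dots> < 0"
  proof (rule mult_neg_pos[OF x])
    have "0 \<le> (1 - x) * d\<^sup>2" using x by simp
    moreover have "0 < real n * q * (b * d)" using pos q Suc by (simp add: b_def d_def)
    ultimately show "0 < (1 - x) * d\<^sup>2 + real n * q * (b * d)" by simp
  qed
  finally show ?thesis .
qed

lemma eulerian_transform_interlacing_step:
  assumes q: "0 < q" "q \<le> 1" and r: "neg_zeros (euler_appell [:q:] n) n r"
  shows "\<exists>s. neg_zeros (euler_appell [:q:] (Suc n)) (Suc n) s \<and> zeros_alternate n r s"
proof (rule interlacing_step[OF r])
  show "poly (euler_appell [:q:] (Suc n)) (r i) * poly (pderiv (euler_appell [:q:] n)) (r i) < 0"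
    if "i < n" for i
    using r that by (intro eulerian_transform_opposite_sign[OF q]) (auto simp: neg_zeros_def)
qed (use q euler_appell_degree_lead_coeff[of 0 q "Suc n"] in \<open>simp_all add: poly_euler_appell_at_0\<close>)

theorem theorem4p4:
  fixes n :: nat and q :: real
  assumes "0 < q" and "q \<le> 1"
  shows "eulerian_op ([:q, 1:] ^ n) \<prec>\<^sub>s eulerian_op ([:q, 1:] ^ (n + 1))
       \<and> (only_real_zeros (eulerian_op ([:q, 1:] ^ n))
          \<and> distinct (zeros_desc (eulerian_op ([:q, 1:] ^ n))))"
proof -
  have "\<exists>r. neg_zeros (euler_appell [:q:] n) n r"
  proof (induction n)
    case 0
    then show ?case by (simp add: neg_zeros_def euler_appell_0)
  next
    case (Suc n)
    then show ?case using eulerian_transform_interlacing_step[OF assms] by blast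
  qed
  then obtain r where r: "neg_zeros (euler_appell [:q:] n) n r" ..
  then obtain s where s: "neg_zeros (euler_appell [:q:] (Suc n)) (Suc n) s" "zeros_alternate n r s"
    using eulerian_transform_interlacing_step[OF assms] by blast
  have "distinct (zeros_desc (euler_appell [:q:] n))"
    using neg_zeros_inj[OF r]
    by (simp add: zeros_desc_if_neg_zeros[OF r] distinct_map lessThan_atLeast0)
  then show ?thesis
    using strictly_interlaces_if_zeros_alternate[OF r s] only_real_zeros_if_neg_zeros[OF r]
    by (simp only: eulerian_op_linear_power Suc_eq_plus1 simp_thms)
qed

end
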